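(* Let $\gamma$ be a real constant, and let $(A_k)_k$ and $(B_k)_k$ be families of adjacency matrices of finite undirected graphs whose continuous-time quantum walks can both be efficiently implemented. Then for all $k$ and all $t\ge0$ $$\exp(-it\gamma(A_k\oplus B_k))=\exp(-it\gamma A_k)\otimes\exp(-it\gamma B_k),$$ and the continuous-time quantum walks on the family of Cartesian product graphs with adjacency matrices $A_k\oplus B_k$ can be efficiently implemented.
   Context: For square matrices $H_1$ ($n_1\times n_1$) and $H_2$ ($n_2\times n_2$), their Cartesian product is the $n_1n_2\times n_1n_2$ matrix $H_1\oplus H_2=H_1\otimes I_{n_2}+I_{n_1}\otimes H_2$ (here $\oplus$ does not denote the direct sum), where $I_n$ is the $n\times n$ identity matrix. The adjacency matrix $A$ of an undirected graph on vertices $v_1,\dots,v_n$ is the symmetric $n\times n$ matrix with $A_{jk}=1$ if $(v_j,v_k)$ is an edge and $0$ otherwise. The continuous-time quantum walk (CTQW) on a graph with adjacency matrix $A$ is the evolution $U(t)=\exp(-itH)$, $t\ge0$, on the Hilbert space $\mathbb{C}^n$ with orthonormal basis indexed by the vertices, where $H=\gamma A$ and $\gamma$ is a fixed real constant (the hopping rate). Efficient implementation: an encoding of $n$ vertices is an injective map from the vertices to the computational basis states of a $q$-qubit register (with $q=m$ if $n=2^m$); it identifies $\mathbb{C}^n$ with a subspace of the register space. A quantum circuit (possibly using additional ancilla qubits that start in and are returned to $|0\rangle$) implements a unitary on $\mathbb{C}^n$ if it acts exactly (error $\epsilon=0$) as that unitary on the encoded subspace. The CTQWs of a family of graphs with adjacency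 matrices $(A^{(k)})_k$ of sizes $n_k$ can be efficiently implemented if there are encodings and a polynomial $p$ such that for every $k$ and every $t\ge0$ the operator $\exp(-it\gamma A^{(k)})$ is implemented by a quantum circuit with at most $p(\log n_k)$ one- and two-qubit gates (arbitrary unitary gates, whose parameters may depend on $t$, while the encoding does not); in particular the bound on the number of gates does not depend on $t$. *)

theory Defs
  imports
    "HOL-Analysis.Analysis"
    "HOL-Computational_Algebra.Polynomial"
    "Jordan_Normal_Form.Matrix"
    "Jordan_Normal_Form.Schur_Decomposition"
begin

section \<open>Graphs and Cartesian products\<close>

text \<open>
  The vertices are \<open>0, \<dots>, n - 1\<close>; an undirected graph is a symmetric relation on them.
  Loops are not excluded.
\<close>

definition undirected_graph :: "nat \<Rightarrow> (nat \<times> nat) set \<Rightarrow> bool" where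
  "undirected_graph n E \<longleftrightarrow> E \<subseteq> {..<n} \<times> {..<n} \<and> sym E"

definition adjacency_matrix :: "nat \<Rightarrow> (nat \<times> nat) set \<Rightarrow> complex mat" where
  "adjacency_matrix n E = mat n n (\<lambda>(j, k). if (j, k) \<in> E then 1 else 0)"

definition is_adjacency_matrix :: "complex mat \<Rightarrow> bool" where
  "is_adjacency_matrix A \<longleftrightarrow> (\<exists>n E. undirected_graph n E \<and> A = adjacency_matrix n E)"

text \<open>
  The pair of indices \<open>(i\<^sub>1, i\<^sub>2)\<close> of a Kronecker product is encoded as \<open>i\<^sub>1 * n\<^sub>2 + i\<^sub>2\<close>.
\<close>

definition kronecker :: "complex mat \<Rightarrow> complex mat \<Rightarrow> complex mat" where
  "kronecker A B = mat (dim_row A * dim_row B) (dim_col A * dim_col B)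
     (\<lambda>(i, j). A $$ (i div dim_row B, j div dim_col B) * B $$ (i mod dim_row B, j mod dim_col B))"

definition cartesian_product_mat :: "complex mat \<Rightarrow> complex mat \<Rightarrow> complex mat" where
  "cartesian_product_mat H\<^sub>1 H\<^sub>2 =
     kronecker H\<^sub>1 (1\<^sub>m (dim_row H\<^sub>2)) + kronecker (1\<^sub>m (dim_row H\<^sub>1)) H\<^sub>2"


section \<open>Continuous-time quantum walks\<close>

text \<open>
  The type of matrices of arbitrary dimension is not a normed algebra, so the exponential
  series is summed entrywise. It converges for every square matrix.
\<close>

definition mat_exp :: "complex mat \<Rightarrow> complex mat" where
  "mat_exp A = mat (dim_row A) (dim_row A)
     (\<lambda>(i, j). \<Sum>r. (A ^\<^sub>m r) $$ (i, j) / fact r)"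

definition ctqw :: "real \<Rightarrow> complex mat \<Rightarrow> real \<Rightarrow> complex mat" where
  "ctqw \<gamma> A t = mat_exp ((- \<i> * complex_of_real t) \<cdot>\<^sub>m (complex_of_real \<gamma> \<cdot>\<^sub>m A))"


section \<open>Quantum circuits\<close>

definition unitary_mat :: "nat \<Rightarrow> complex mat \<Rightarrow> bool" where
  "unitary_mat n U \<longleftrightarrow>
     U \<in> carrier_mat n n \<and> mat_adjoint U * U = 1\<^sub>m n \<and> U * mat_adjoint U = 1\<^sub>m n"

datatype gate =
    One_Qubit nat "complex mat"
  | Two_Qubit nat nat "complex mat"

text \<open>
  The computational basis states of \<open>m\<close> qubits are the numbers below \<open>2 ^ m\<close>, and qubit \<open>l\<close> of the
  state \<open>x\<close> has the value \<open>bit x l\<close>. The basis state of a pair of qubits \<open>(i, j)\<close> is numbered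
  with the value of \<open>i\<close> as the more significant bit.
\<close>

fun valid_gate :: "nat \<Rightarrow> gate \<Rightarrow> bool" where
  "valid_gate m (One_Qubit i U) \<longleftrightarrow> i < m \<and> unitary_mat 2 U"
| "valid_gate m (Two_Qubit i j U) \<longleftrightarrow> i < m \<and> j < m \<and> i \<noteq> j \<and> unitary_mat 4 U"

fun gate_mat :: "nat \<Rightarrow> gate \<Rightarrow> complex mat" where
  "gate_mat m (One_Qubit i U) = mat (2 ^ m) (2 ^ m) (\<lambda>(x, y).
     if \<forall>l<m. l \<noteq> i \<longrightarrow> bit x l = bit y l
     then U $$ (of_bool (bit x i), of_bool (bit y i)) else 0)"
| "gate_mat m (Two_Qubit i j U) = mat (2 ^ m) (2 ^ m) (\<lambda>(x, y).
     if \<forall>l<m. l \<noteq> i \<and> l \<noteq> j \<longrightarrow> bit x l = bit y l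
     then U $$ (2 * of_bool (bit x i) + of_bool (bit x j),
                2 * of_bool (bit y i) + of_bool (bit y j)) else 0)"

text \<open>The first gate of the list acts first.\<close>

fun circuit_mat :: "nat \<Rightarrow> gate list \<Rightarrow> complex mat" where
  "circuit_mat m [] = 1\<^sub>m (2 ^ m)"
| "circuit_mat m (g # gs) = circuit_mat m gs * gate_mat m g"


section \<open>Efficient implementation\<close>

definition encoding :: "nat \<Rightarrow> nat \<Rightarrow> (nat \<Rightarrow> nat) \<Rightarrow> bool" where
  "encoding n q e \<longleftrightarrow>
     inj_on e {..<n} \<and> e ` {..<n} \<subseteq> {..<2 ^ q} \<and> (\<forall>m. n = 2 ^ m \<longrightarrow> q = m)"

text \<open>
  The embedding of \<open>\<complex>\<^sup>n\<close> into the space of \<open>m\<close> qubits that sends the \<open>j\<close>-th basis vector to the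
  basis state \<open>e j\<close>.
\<close>

definition encoding_mat :: "nat \<Rightarrow> nat \<Rightarrow> (nat \<Rightarrow> nat) \<Rightarrow> complex mat" where
  "encoding_mat m n e = mat (2 ^ m) n (\<lambda>(x, j). if x = e j then 1 else 0)"

text \<open>
  The \<open>a\<close> ancilla qubits are the qubits \<open>q, \<dots>, q + a - 1\<close>. Since \<open>e j < 2 ^ q\<close>, the basis state
  \<open>e j\<close> of all \<open>q + a\<close> qubits is the register state \<open>e j\<close> with every ancilla in the state zero.
  The equation below thus says both that the circuit acts as \<open>V\<close> on the encoded subspace and
  that the ancillas are returned to zero.
\<close>

definition implements ::
    "nat \<Rightarrow> nat \<Rightarrow> (nat \<Rightarrow> nat) \<Rightarrow> nat \<Rightarrow> gate list \<Rightarrow> complex mat \<Rightarrow> bool" where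
  "implements n q e a C V \<longleftrightarrow>
     (\<forall>g \<in> set C. valid_gate (q + a) g) \<and>
     circuit_mat (q + a) C * encoding_mat (q + a) n e = encoding_mat (q + a) n e * V"

definition efficiently_implementable_ctqw :: "real \<Rightarrow> ('k \<Rightarrow> complex mat) \<Rightarrow> bool" where
  "efficiently_implementable_ctqw \<gamma> A \<longleftrightarrow>
     (\<exists>(q :: 'k \<Rightarrow> nat) (e :: 'k \<Rightarrow> nat \<Rightarrow> nat) (p :: real poly).
        \<forall>k. encoding (dim_row (A k)) (q k) (e k) \<and>
            (\<forall>t\<ge>0. \<exists>a C.
               implements (dim_row (A k)) (q k) (e k) a C (ctqw \<gamma> (A k) t) \<and>
               real (length C) \<le> poly p (log 2 (real (dim_row (A k))))))"

end

theory Submission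
  imports Defs
begin

text \<open>
  The summands \<open>A \<otimes> I\<close> and \<open>I \<otimes> B\<close> commute, so the binomial theorem and the Cauchy product of the
  exponential series turn the walk on the product into the Kronecker product of the two walks.
  Encoding a pair of vertices by juxtaposing the two registers, the circuit for \<open>A\<close> followed by the
  circuit for \<open>B\<close>, each on its own register, implements this Kronecker product. The gate
  counts add up, and \<open>log (n\<^sub>1 n\<^sub>2) = log n\<^sub>1 + log n\<^sub>2\<close> dominates both logarithms, so the sum of
  monotone majorants of the two polynomials bounds the number of gates. The qubit-count condition
  for \<open>n\<^sub>1 n\<^sub>2 = 2 ^ m\<close> is inherited because both factors are then powers of two.
\<close>

section \<open>Kronecker products\<close>

text \<open>The numbers with quotient \<open>i\<close> by \<open>b\<close> form the block of length
  \<open>b\<close> that starts at \<open>i * b\<close>. This turns a sum over a Kronecker index into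
  a double sum.\<close>

lemma sum_div_mod:
  fixes f :: "nat \<Rightarrow> nat \<Rightarrow> 'a::comm_monoid_add"
  shows "(\<Sum>k<a * b. f (k div b) (k mod b)) = (\<Sum>i<a. \<Sum>j<b. f i j)"
proof -
  have "(\<Sum>i<a. \<Sum>j<b. f i j) = (\<Sum>i<a. \<Sum>k=i * b..<i * b + b. f (k div b) (k mod b))"
  proof (rule sum.cong[OF refl])
    fix i
    show "(\<Sum>j<b. f i j) = (\<Sum>k=i * b..<i * b + b. f (k div b) (k mod b))"
      by (subst sum.atLeastLessThan_shift_0) (simp add: atLeast0LessThan)
  qed
  then show ?thesis
    using sum.nat_group[of "\<lambda>k. f (k div b) (k mod b)" b a] by simp
qed

lemma mod_less_of_less_mult: "i < a * b \<Longrightarrow> i mod b < (b::nat)"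
  by (cases "b = 0") simp_all

lemma mult_add_less_mult: "k < a \<Longrightarrow> r < b \<Longrightarrow> k * b + r < a * (b::nat)"
  using mult_le_mono1[of "Suc k" a b] by simp

lemma dim_kronecker [simp]:
  "dim_row (kronecker A B) = dim_row A * dim_row B"
  "dim_col (kronecker A B) = dim_col A * dim_col B"
  by (simp_all add: kronecker_def)

lemma index_kronecker [simp]:
  "i < dim_row A * dim_row B \<Longrightarrow> j < dim_col A * dim_col B \<Longrightarrow>
   kronecker A B $$ (i, j) =
     A $$ (i div dim_row B, j div dim_col B) * B $$ (i mod dim_row B, j mod dim_col B)"
  by (simp add: kronecker_def)

lemma index_mult_mat_sum:
  "i < dim_row A \<Longrightarrow> j < dim_col B \<Longrightarrow> dim_col A = dim_row B \<Longrightarrow>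
   (A * B) $$ (i, j) = (\<Sum>k<dim_row B. A $$ (i, k) * B $$ (k, j))"
  by (simp add: scalar_prod_def atLeast0LessThan)

text \<open>The mixed-product rule: after the sum over the joint inner index is split, its terms
  separate into a factor in \<open>k\<close> and a factor in \<open>l\<close>.\<close>

lemma kronecker_mult:
  assumes "dim_col A = dim_row C" and "dim_col B = dim_row D"
  shows "kronecker A B * kronecker C D = kronecker (A * C) (B * D)"
proof (rule eq_matI)
  fix i j assume "i < dim_row (kronecker (A * C) (B * D))" "j < dim_col (kronecker (A * C) (B * D))"
  then have i: "i < dim_row A * dim_row B" and j: "j < dim_col C * dim_col D"
    by simp_all
  note bounds = less_mult_imp_div_less[OF i] less_mult_imp_div_less[OF j]
    mod_less_of_less_mult[OF i] mod_less_of_less_mult[OF j]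
  let ?f = "\<lambda>k l. A $$ (i div dim_row B, k) * B $$ (i mod dim_row B, l) *
    (C $$ (k, j div dim_col D) * D $$ (l, j mod dim_col D))"
  have "(kronecker A B * kronecker C D) $$ (i, j) =
      (\<Sum>k<dim_row C * dim_row D. kronecker A B $$ (i, k) * kronecker C D $$ (k, j))"
    using i j assms by (simp add: index_mult_mat_sum del: index_mult_mat(1) index_kronecker)
  also have "\<dots> = (\<Sum>k<dim_row C * dim_row D. ?f (k div dim_row D) (k mod dim_row D))"
    using i j assms by (intro sum.cong) simp_all
  also have "\<dots> = (\<Sum>k<dim_row C. \<Sum>l<dim_row D. ?f k l)"
    by (rule sum_div_mod)
  also have "\<dots> = (\<Sum>k<dim_row C. A $$ (i div dim_row B, k) * C $$ (k, j div dim_col D)) *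
      (\<Sum>l<dim_row D. B $$ (i mod dim_row B, l) * D $$ (l, j mod dim_col D))"
    by (simp add: sum_product mult_ac)
  also have "\<dots> = (A * C) $$ (i div dim_row B, j div dim_col D) *
      (B * D) $$ (i mod dim_row B, j mod dim_col D)"
    using assms bounds by (simp add: index_mult_mat_sum del: index_mult_mat(1))
  finally show "(kronecker A B * kronecker C D) $$ (i, j) = kronecker (A * C) (B * D) $$ (i, j)"
    using i j by simp
qed simp_all

lemma dim_cartesian_product_mat [simp]:
  "dim_row (cartesian_product_mat X Y) = dim_row X * dim_row Y"
  "dim_col (cartesian_product_mat X Y) = dim_row X * dim_col Y"
  by (simp_all add: cartesian_product_mat_def)

lemma smult_cartesian_product_mat:
  assumes "X \<in> carrier_mat n n" and "Y \<in> carrier_mat m m"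
  shows "c \<cdot>\<^sub>m cartesian_product_mat X Y = cartesian_product_mat (c \<cdot>\<^sub>m X) (c \<cdot>\<^sub>m Y)"
  using assms
  by (intro eq_matI)
    (auto simp: cartesian_product_mat_def less_mult_imp_div_less mod_less_of_less_mult algebra_simps)

section \<open>Exponentials of Cartesian products\<close>

text \<open>The binomial theorem for the commuting summands \<open>kronecker X 1\<close> and
  \<open>kronecker 1 Y\<close>, stated entrywise so that it feeds directly into the entrywise
  exponential series.\<close>

lemma index_pow_cartesian_product_mat:
  assumes X: "X \<in> carrier_mat n n" and Y: "Y \<in> carrier_mat m m"
    and i: "i < n * m" and j: "j < n * m"
  shows "(cartesian_product_mat X Y ^\<^sub>m r) $$ (i, j) =
    (\<Sum>s\<le>r. of_nat (r choose s) * ((X ^\<^sub>m s) $$ (i div m, j div m) * (Y ^\<^sub>m (r - s)) $$ (i mod m, j mod m)))"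
  using j
proof (induction r arbitrary: j)
  case 0
  have "i = j" if "i div m = j div m" "i mod m = j mod m"
    using that by (metis div_mult_mod_eq)
  then show ?case
    using X Y i 0 by (auto simp: less_mult_imp_div_less mod_less_of_less_mult)
next
  case (Suc r)
  let ?M = "cartesian_product_mat X Y"
  let ?K = "\<lambda>s. kronecker (X ^\<^sub>m s) (Y ^\<^sub>m (r - s))"
  let ?P = "\<lambda>s u. (X ^\<^sub>m s) $$ (i div m, j div m) * (Y ^\<^sub>m u) $$ (i mod m, j mod m)"
  note [simp] = carrier_matD[OF X] carrier_matD[OF Y]
  have M: "?M \<in> carrier_mat (n * m) (n * m)"
    by (intro carrier_matI) simp_all
  have pow: "X ^\<^sub>m s \<in> carrier_mat n n" "Y ^\<^sub>m s \<in> carrier_mat m m" for s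
    using X Y by (auto intro: pow_carrier_mat)
  note [simp del] = pow_mat_dim
  note [simp] = pow[THEN carrier_matD(1)] pow[THEN carrier_matD(2)]
  have Mpow: "?M ^\<^sub>m r \<in> carrier_mat (n * m) (n * m)"
    using M by (rule pow_carrier_mat)
  note [simp] = carrier_matD[OF Mpow]
  \<comment> \<open>By the mixed-product rule, the two summands of \<open>?M\<close> raise the
    exponent of \<open>X\<close> and of \<open>Y\<close> by one, respectively.\<close>
  have step: "(?K s * ?M) $$ (i, j) = ?P (Suc s) (r - s) + ?P s (Suc (r - s))" for s
  proof -
    have "?K s * ?M = ?K s * kronecker X (1\<^sub>m m) + ?K s * kronecker (1\<^sub>m n) Y"
      unfolding cartesian_product_mat_def carrier_matD(1)[OF X] carrier_matD(1)[OF Y]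
      by (rule mult_add_distrib_mat[of _ "n * m" "n * m" _ "n * m"]) (auto intro!: carrier_matI)
    also have "\<dots> = kronecker (X ^\<^sub>m Suc s) (Y ^\<^sub>m (r - s)) + kronecker (X ^\<^sub>m s) (Y ^\<^sub>m Suc (r - s))"
      by (simp add: kronecker_mult right_mult_one_mat[OF pow(2)] right_mult_one_mat[OF pow(1)])
    finally show ?thesis
      using i Suc.prems by (simp del: pow_mat.simps)
  qed
  have "(?M ^\<^sub>m Suc r) $$ (i, j) = (\<Sum>k<n * m. (?M ^\<^sub>m r) $$ (i, k) * ?M $$ (k, j))"
    using i Suc.prems by (simp add: index_mult_mat_sum del: index_mult_mat(1))
  also have "\<dots> = (\<Sum>k<n * m. (\<Sum>s\<le>r. of_nat (r choose s) * ?K s $$ (i, k)) * ?M $$ (k, j))"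
    using i by (intro sum.cong) (simp_all add: Suc.IH)
  also have "\<dots> = (\<Sum>s\<le>r. of_nat (r choose s) * (\<Sum>k<n * m. ?K s $$ (i, k) * ?M $$ (k, j)))"
    by (simp add: sum_distrib_right sum_distrib_left mult.assoc sum.swap[of _ _ "{..<n * m}"])
  also have "\<dots> = (\<Sum>s\<le>r. of_nat (r choose s) * (?K s * ?M) $$ (i, j))"
  proof (intro sum.cong refl arg_cong2[where f = "(*)"])
    fix s
    show "(\<Sum>k<n * m. ?K s $$ (i, k) * ?M $$ (k, j)) = (?K s * ?M) $$ (i, j)"
      using i Suc.prems by (simp add: index_mult_mat_sum del: index_mult_mat(1) index_kronecker)
  qed
  also have "\<dots> = (\<Sum>s\<le>r. of_nat (r choose s) * ?P (Suc s) (r - s)) +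
      (\<Sum>s\<le>r. of_nat (r choose s) * ?P s (Suc r - s))"
    by (simp only: step distrib_left sum.distrib) (simp add: Suc_diff_le)
  \<comment> \<open>The added term \<open>s = Suc r\<close> vanishes because
    \<open>r choose Suc r = 0\<close>; it makes the index shift possible.\<close>
  also have "(\<Sum>s\<le>r. of_nat (r choose s) * ?P s (Suc r - s)) =
      (\<Sum>s\<le>Suc r. of_nat (r choose s) * ?P s (Suc r - s))"
    by (simp del: pow_mat.simps)
  also have "\<dots> = ?P 0 (Suc r) + (\<Sum>s\<le>r. of_nat (r choose Suc s) * ?P (Suc s) (r - s))"
    by (subst sum.atMost_Suc_shift) (simp del: pow_mat.simps)
  \<comment> \<open>Pascal's rule merges \<open>r choose s\<close> and
    \<open>r choose Suc s\<close>.\<close>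
  finally have "(?M ^\<^sub>m Suc r) $$ (i, j) =
      ?P 0 (Suc r) + (\<Sum>s\<le>r. of_nat (Suc r choose Suc s) * ?P (Suc s) (r - s))"
    by (simp add: sum.distrib algebra_simps del: pow_mat.simps)
  then show ?case
    by (subst sum.atMost_Suc_shift) (simp del: pow_mat.simps)
qed

section \<open>Absolute convergence of the exponential series\<close>

lemma norm_index_pow_mat_le:
  fixes X :: "complex mat"
  assumes X: "X \<in> carrier_mat n n" and c: "\<And>i j. i < n \<Longrightarrow> j < n \<Longrightarrow> norm (X $$ (i, j)) \<le> c"
    and i: "i < n" and j: "j < n"
  shows "norm ((X ^\<^sub>m r) $$ (i, j)) \<le> (real n * c) ^ r"
  using j
proof (induction r arbitrary: j)
  case 0
  then show ?case using X i by simp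
next
  case (Suc r)
  have "0 \<le> c"
    using c[OF i i] norm_ge_zero by (rule order_trans[rotated])
  have "X ^\<^sub>m r \<in> carrier_mat n n"
    using X by (rule pow_carrier_mat)
  then have "norm ((X ^\<^sub>m Suc r) $$ (i, j)) = norm (\<Sum>k<n. (X ^\<^sub>m r) $$ (i, k) * X $$ (k, j))"
    using X i Suc.prems by (simp add: index_mult_mat_sum del: index_mult_mat(1))
  \<comment> \<open>Each of the \<open>n\<close> summands gains a factor of norm at most
    \<open>c\<close>, so one more power costs a factor \<open>n * c\<close>.\<close>
  also have "\<dots> \<le> (\<Sum>k<n. (real n * c) ^ r * c)"
    using Suc \<open>0 \<le> c\<close> by (intro sum_norm_le) (auto simp: norm_mult intro!: mult_mono c)
  finally show ?case
    by (simp add: mult_ac)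
qed

text \<open>With \<open>c\<close> the largest norm of an entry, the series is dominated by the
  scalar exponential series at \<open>n * c\<close>. Absolute convergence is what the Cauchy product
  requires.\<close>

lemma summable_norm_mat_exp:
  fixes X :: "complex mat"
  assumes X: "X \<in> carrier_mat n n" and i: "i < n" and j: "j < n"
  shows "summable (\<lambda>r. norm ((X ^\<^sub>m r) $$ (i, j) / fact r))"
proof -
  define c where "c = Max ((\<lambda>(i, j). norm (X $$ (i, j))) ` ({..<n} \<times> {..<n}))"
  have c: "norm (X $$ (i, j)) \<le> c" if "i < n" "j < n" for i j
    unfolding c_def using that by (intro Max_ge) auto
  have "summable (\<lambda>r. (real n * c) ^ r / fact r)"
    using summable_exp[of "real n * c"] by (simp add: field_simps)
  then show ?thesis
    by (rule summable_comparison_test'[where N = 0])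
      (auto simp: norm_divide intro!: divide_right_mono norm_index_pow_mat_le[OF X c i j])
qed

lemma dim_mat_exp [simp]: "dim_row (mat_exp X) = dim_row X" "dim_col (mat_exp X) = dim_row X"
  by (simp_all add: mat_exp_def)

lemma index_mat_exp:
  "i < dim_row X \<Longrightarrow> j < dim_row X \<Longrightarrow> mat_exp X $$ (i, j) = (\<Sum>r. (X ^\<^sub>m r) $$ (i, j) / fact r)"
  by (simp add: mat_exp_def)

lemma mat_exp_cartesian_product_mat:
  assumes X: "X \<in> carrier_mat n n" and Y: "Y \<in> carrier_mat m m"
  shows "mat_exp (cartesian_product_mat X Y) = kronecker (mat_exp X) (mat_exp Y)"
proof (rule eq_matI)
  fix i j assume "i < dim_row (kronecker (mat_exp X) (mat_exp Y))"
    and "j < dim_col (kronecker (mat_exp X) (mat_exp Y))"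
  then have i: "i < n * m" and j: "j < n * m"
    using X Y by auto
  note bounds = less_mult_imp_div_less[OF i] less_mult_imp_div_less[OF j]
    mod_less_of_less_mult[OF i] mod_less_of_less_mult[OF j]
  let ?x = "\<lambda>s. (X ^\<^sub>m s) $$ (i div m, j div m) / fact s"
  let ?y = "\<lambda>s. (Y ^\<^sub>m s) $$ (i mod m, j mod m) / fact s"
  have "(\<Sum>r. (cartesian_product_mat X Y ^\<^sub>m r) $$ (i, j) / fact r) =
      (\<Sum>r. \<Sum>s\<le>r. ?x s * ?y (r - s))"
  proof (intro arg_cong[where f = suminf] ext)
    fix r
    \<comment> \<open>Dividing by \<open>fact r\<close> turns \<open>r choose s\<close> into the
      product of \<open>1 / fact s\<close> and \<open>1 / fact (r - s)\<close>, the form of a Cauchy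
      product.\<close>
    show "(cartesian_product_mat X Y ^\<^sub>m r) $$ (i, j) / fact r = (\<Sum>s\<le>r. ?x s * ?y (r - s))"
      unfolding index_pow_cartesian_product_mat[OF X Y i j] sum_divide_distrib
      by (intro sum.cong) (auto simp: binomial_fact)
  qed
  also have "\<dots> = (\<Sum>r. ?x r) * (\<Sum>r. ?y r)"
    using summable_norm_mat_exp[OF X] summable_norm_mat_exp[OF Y] bounds
    by (intro Cauchy_product[symmetric]) auto
  also have "\<dots> = kronecker (mat_exp X) (mat_exp Y) $$ (i, j)"
    using X Y i j bounds by (simp add: index_mat_exp)
  finally show "mat_exp (cartesian_product_mat X Y) $$ (i, j) =
      kronecker (mat_exp X) (mat_exp Y) $$ (i, j)"
    using X Y i j by (subst index_mat_exp) (simp_all only: dim_cartesian_product_mat carrier_matD)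
qed (use X Y in simp_all)

lemma ctqw_cartesian_product_mat:
  assumes "A \<in> carrier_mat n n" and "B \<in> carrier_mat m m"
  shows "ctqw \<gamma> (cartesian_product_mat A B) t = kronecker (ctqw \<gamma> A t) (ctqw \<gamma> B t)"
  unfolding ctqw_def using assms
  by (simp add: smult_cartesian_product_mat[where n = n and m = m]
      mat_exp_cartesian_product_mat[where n = n and m = m])

section \<open>Relabelling the qubits of a circuit\<close>

definition nat_of_bits :: "nat \<Rightarrow> (nat \<Rightarrow> bool) \<Rightarrow> nat" where
  "nat_of_bits m P = horner_sum of_bool 2 (map P [0..<m])"

lemma bit_nat_of_bits [simp]: "bit (nat_of_bits m P) l \<longleftrightarrow> l < m \<and> P l"
  by (auto simp: nat_of_bits_def bit_horner_sum_bit_iff)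

lemma nat_of_bits_less [simp]: "nat_of_bits m P < 2 ^ m"
  using horner_sum_of_bool_2_less[of "map P [0..<m]"] unfolding nat_of_bits_def by simp

lemma bit_nat_less_exp_imp_less: "bit x l \<Longrightarrow> x < 2 ^ m \<Longrightarrow> l < m" for x :: nat
  by (metis bit_take_bit_iff take_bit_nat_eq_self)

lemma nat_eq_iff_bits: "x < 2 ^ m \<Longrightarrow> y < 2 ^ m \<Longrightarrow> x = y \<longleftrightarrow> (\<forall>l<m. bit x l = bit y l)" for x y :: nat
  by (metis bit_eq_iff bit_nat_less_exp_imp_less)

text \<open>Qubit \<open>l\<close> of a circuit on \<open>k\<close> qubits is placed at position
  \<open>\<sigma> l\<close> of a larger register; this reads off the state of the small circuit's
  qubits.\<close>

definition pull_bits :: "(nat \<Rightarrow> nat) \<Rightarrow> nat \<Rightarrow> nat \<Rightarrow> nat" where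
  "pull_bits \<sigma> k x = nat_of_bits k (\<lambda>l. bit x (\<sigma> l))"

lemma bit_pull_bits [simp]: "bit (pull_bits \<sigma> k x) l \<longleftrightarrow> l < k \<and> bit x (\<sigma> l)"
  and pull_bits_less [simp]: "pull_bits \<sigma> k x < 2 ^ k"
  by (simp_all add: pull_bits_def)

text \<open>Operators acting only on the qubits in \<open>S\<close> connect only basis states
  related in this way.\<close>

definition agree_off :: "nat set \<Rightarrow> nat \<Rightarrow> nat \<Rightarrow> nat \<Rightarrow> bool" where
  "agree_off S m x y \<longleftrightarrow> (\<forall>l<m. l \<notin> S \<longrightarrow> bit x l = bit y l)"

lemma eq_iff_agree_off_pull_bits:
  assumes "\<sigma> ` {..<k} \<subseteq> {..<m}" and "x < 2 ^ m" and "y < 2 ^ m"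
  shows "x = y \<longleftrightarrow> agree_off (\<sigma> ` {..<k}) m x y \<and> pull_bits \<sigma> k x = pull_bits \<sigma> k y"
  using assms unfolding nat_eq_iff_bits[OF assms(2,3)] nat_eq_iff_bits[OF pull_bits_less pull_bits_less]
  by (auto simp: agree_off_def)

text \<open>Once the qubits outside the image of \<open>\<sigma>\<close> are frozen as in
  \<open>x\<close>, the remaining \<open>k\<close> qubits are free. This reindexes sums over
  intermediate basis states.\<close>

lemma bij_betw_pull_bits:
  assumes inj: "inj_on \<sigma> {..<k}" and sub: "\<sigma> ` {..<k} \<subseteq> {..<m}"
  shows "bij_betw (pull_bits \<sigma> k) {z. z < 2 ^ m \<and> agree_off (\<sigma> ` {..<k}) m x z} {..<2 ^ k}"
proof (rule bij_betw_imageI)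
  show "inj_on (pull_bits \<sigma> k) {z. z < 2 ^ m \<and> agree_off (\<sigma> ` {..<k}) m x z}"
    by (rule inj_onI) (auto simp: eq_iff_agree_off_pull_bits[OF sub], auto simp: agree_off_def)
  have "w \<in> pull_bits \<sigma> k ` {z. z < 2 ^ m \<and> agree_off (\<sigma> ` {..<k}) m x z}" if w: "w < 2 ^ k" for w
  proof (rule image_eqI)
    \<comment> \<open>The preimage of \<open>w\<close> carries the bits of \<open>w\<close> on the
      image of \<open>\<sigma>\<close> and those of \<open>x\<close> elsewhere.\<close>
    let ?z = "nat_of_bits m (\<lambda>l. if l \<in> \<sigma> ` {..<k} then bit w (inv_into {..<k} \<sigma> l) else bit x l)"
    show "w = pull_bits \<sigma> k ?z"
      using inj sub unfolding nat_eq_iff_bits[OF w pull_bits_less] by auto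
    show "?z \<in> {z. z < 2 ^ m \<and> agree_off (\<sigma> ` {..<k}) m x z}"
      by (auto simp: agree_off_def)
  qed
  then show "pull_bits \<sigma> k ` {z. z < 2 ^ m \<and> agree_off (\<sigma> ` {..<k}) m x z} = {..<2 ^ k}"
    by auto
qed

section \<open>Relabelled gates and circuits as tensor products with an identity\<close>

fun relabel_gate :: "(nat \<Rightarrow> nat) \<Rightarrow> gate \<Rightarrow> gate" where
  "relabel_gate \<sigma> (One_Qubit i U) = One_Qubit (\<sigma> i) U"
| "relabel_gate \<sigma> (Two_Qubit i j U) = Two_Qubit (\<sigma> i) (\<sigma> j) U"

lemma valid_relabel_gate:
  assumes "inj_on \<sigma> {..<k}" and "\<sigma> ` {..<k} \<subseteq> {..<m}" and "valid_gate k g"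
  shows "valid_gate m (relabel_gate \<sigma> g)"
  using assms by (cases g) (auto dest: inj_onD)

lemma gate_mat_carrier [simp]: "gate_mat m g \<in> carrier_mat (2 ^ m) (2 ^ m)"
  by (cases g) auto

lemma circuit_mat_carrier [simp]: "circuit_mat m C \<in> carrier_mat (2 ^ m) (2 ^ m)"
  by (induction C) (auto intro: mult_carrier_mat)

lemma circuit_mat_append: "circuit_mat m (C @ D) = circuit_mat m D * circuit_mat m C"
proof (induction C)
  case (Cons g C)
  then show ?case
    by (simp add: assoc_mult_mat[OF circuit_mat_carrier circuit_mat_carrier gate_mat_carrier])
qed (simp add: right_mult_one_mat[OF circuit_mat_carrier])

text \<open>The qubits untouched by the relabelled gate are those outside the image of
  \<open>\<sigma>\<close> and the images of those untouched by \<open>g\<close>, so the agreement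
  condition splits in two.\<close>

lemma gate_mat_relabel:
  assumes inj: "inj_on \<sigma> {..<k}" and sub: "\<sigma> ` {..<k} \<subseteq> {..<m}"
    and g: "valid_gate k g" and x: "x < 2 ^ m" and y: "y < 2 ^ m"
  shows "gate_mat m (relabel_gate \<sigma> g) $$ (x, y) =
    (if agree_off (\<sigma> ` {..<k}) m x y then gate_mat k g $$ (pull_bits \<sigma> k x, pull_bits \<sigma> k y) else 0)"
proof (cases g)
  case (One_Qubit i U)
  with g have i: "i < k" by simp
  have *: "(\<forall>l<m. l \<noteq> \<sigma> i \<longrightarrow> bit x l = bit y l) \<longleftrightarrow> agree_off (\<sigma> ` {..<k}) m x y \<and>
      (\<forall>l<k. l \<noteq> i \<longrightarrow> bit x (\<sigma> l) = bit y (\<sigma> l))"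
    using inj sub i unfolding agree_off_def inj_on_def image_subset_iff by (auto; blast)
  then show ?thesis
    using x y i by (simp add: One_Qubit * cong: conj_cong imp_cong)
next
  case (Two_Qubit i j U)
  with g have ij: "i < k" "j < k" by simp_all
  have *: "(\<forall>l<m. l \<noteq> \<sigma> i \<and> l \<noteq> \<sigma> j \<longrightarrow> bit x l = bit y l) \<longleftrightarrow> agree_off (\<sigma> ` {..<k}) m x y \<and>
      (\<forall>l<k. l \<noteq> i \<and> l \<noteq> j \<longrightarrow> bit x (\<sigma> l) = bit y (\<sigma> l))"
    using inj sub ij unfolding agree_off_def inj_on_def image_subset_iff by (auto; blast)
  then show ?thesis
    using x y ij by (simp add: Two_Qubit * cong: conj_cong imp_cong)
qed

lemma circuit_mat_relabel:
  assumes inj: "inj_on \<sigma> {..<k}" and sub: "\<sigma> ` {..<k} \<subseteq> {..<m}"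
    and "\<forall>g\<in>set C. valid_gate k g" and "x < 2 ^ m" and y: "y < 2 ^ m"
  shows "circuit_mat m (map (relabel_gate \<sigma>) C) $$ (x, y) =
    (if agree_off (\<sigma> ` {..<k}) m x y then circuit_mat k C $$ (pull_bits \<sigma> k x, pull_bits \<sigma> k y) else 0)"
  using assms(3-)
proof (induction C arbitrary: y)
  case Nil
  then show ?case
    by (auto simp: eq_iff_agree_off_pull_bits[OF sub])
next
  case (Cons g C)
  let ?S = "\<sigma> ` {..<k}"
  let ?p = "pull_bits \<sigma> k"
  let ?C = "circuit_mat k C" and ?g = "gate_mat k g"
  let ?Z = "{z. z < 2 ^ m \<and> agree_off ?S m x z}"
  have "circuit_mat m (map (relabel_gate \<sigma>) (g # C)) $$ (x, y) =
      (\<Sum>z<2 ^ m. circuit_mat m (map (relabel_gate \<sigma>) C) $$ (x, z) * gate_mat m (relabel_gate \<sigma> g) $$ (z, y))"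
    unfolding list.map circuit_mat.simps
    using Cons.prems carrier_matD[OF circuit_mat_carrier] carrier_matD[OF gate_mat_carrier]
    by (subst index_mult_mat_sum) auto
  \<comment> \<open>When \<open>z\<close> agrees with \<open>x\<close> off the image, agreement of
    \<open>z\<close> with \<open>y\<close> is the same as agreement of \<open>x\<close> with
    \<open>y\<close>.\<close>
  also have "\<dots> = (\<Sum>z<2 ^ m. if agree_off ?S m x z
      then ?C $$ (?p x, ?p z) * (if agree_off ?S m x y then ?g $$ (?p z, ?p y) else 0) else 0)"
    using Cons
    by (intro sum.cong) (auto simp: gate_mat_relabel[OF inj sub], auto simp: agree_off_def)
  also have "\<dots> = (\<Sum>z\<in>?Z. ?C $$ (?p x, ?p z) * (if agree_off ?S m x y then ?g $$ (?p z, ?p y) else 0))"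
    by (subst sum.inter_filter[symmetric]) (auto intro!: sum.cong)
  also have "\<dots> = (\<Sum>w<2 ^ k. ?C $$ (?p x, w) * (if agree_off ?S m x y then ?g $$ (w, ?p y) else 0))"
    by (rule sum.reindex_bij_betw[OF bij_betw_pull_bits[OF inj sub]])
  also have "\<dots> = (if agree_off ?S m x y then (?C * ?g) $$ (?p x, ?p y) else 0)"
    using carrier_matD[OF circuit_mat_carrier] carrier_matD[OF gate_mat_carrier]
    by (subst index_mult_mat_sum) auto
  finally show ?case
    by simp
qed

section \<open>Circuits acting on encoded vectors\<close>

lemma index_mult_encoding_mat:
  assumes "M \<in> carrier_mat (2 ^ m) (2 ^ m)" and "x < 2 ^ m" and "j < n" and "f j < 2 ^ m"
  shows "(M * encoding_mat m n f) $$ (x, j) = M $$ (x, f j)"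
proof -
  have "(M * encoding_mat m n f) $$ (x, j) = (\<Sum>z<2 ^ m. if z = f j then M $$ (x, z) else 0)"
    using assms
    by (subst index_mult_mat_sum) (auto simp: encoding_mat_def simp del: sum.delta sum.delta' intro!: sum.cong)
  then show ?thesis
    using assms by simp
qed

lemma index_encoding_mat_mult:
  assumes "V \<in> carrier_mat n n" and "x < 2 ^ m" and "j < n"
  shows "(encoding_mat m n f * V) $$ (x, j) = (\<Sum>i<n. if x = f i then V $$ (i, j) else 0)"
  using assms by (subst index_mult_mat_sum) (auto simp: encoding_mat_def intro!: sum.cong)

text \<open>
  A circuit that implements \<open>V\<close> acts, after relabelling its qubits, as \<open>V\<close> on the \<open>\<pi>\<close>-component
  of the encoded index and as the identity on the \<open>\<rho>\<close>-component.
\<close>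

lemma circuit_mat_relabel_encoding_mat:
  assumes inj: "inj_on \<sigma> {..<q + a}" and sub: "\<sigma> ` {..<q + a} \<subseteq> {..<m}"
    and C: "implements n q e a C V" and V: "V \<in> carrier_mat n n" and W: "W \<in> carrier_mat N N"
    and f: "\<And>i. i < N \<Longrightarrow> f i < 2 ^ m"
    and pull: "\<And>i. i < N \<Longrightarrow> pull_bits \<sigma> (q + a) (f i) = e (\<pi> i)"
    and agree: "\<And>i j. i < N \<Longrightarrow> j < N \<Longrightarrow> \<rho> i = \<rho> j \<Longrightarrow> agree_off (\<sigma> ` {..<q + a}) m (f i) (f j)"
    and bij: "\<And>j. j < N \<Longrightarrow> bij_betw \<pi> {i. i < N \<and> \<rho> i = \<rho> j} {..<n}"
    and W_index: "\<And>i j. i < N \<Longrightarrow> j < N \<Longrightarrow> W $$ (i, j) = (if \<rho> i = \<rho> j then V $$ (\<pi> i, \<pi> j) else 0)"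
  shows "circuit_mat m (map (relabel_gate \<sigma>) C) * encoding_mat m N f = encoding_mat m N f * W"
    (is "?D * ?F = ?F * W")
proof (rule eq_matI)
  let ?S = "\<sigma> ` {..<q + a}" and ?p = "pull_bits \<sigma> (q + a)" and ?C = "circuit_mat (q + a) C"
  let ?E = "encoding_mat (q + a) n e"
  fix x j assume "x < dim_row (?F * W)" and "j < dim_col (?F * W)"
  then have x: "x < 2 ^ m" and j: "j < N"
    using W by (auto simp: encoding_mat_def)
  have \<pi>j: "\<pi> j < n"
    using bij_betw_apply[OF bij[OF j], of j] j by simp
  have "(?D * ?F) $$ (x, j) = ?D $$ (x, f j)"
    using x j f by (intro index_mult_encoding_mat) simp_all
  also have "\<dots> = (if agree_off ?S m x (f j) then ?C $$ (?p x, e (\<pi> j)) else 0)"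
    using C pull[OF j] by (subst circuit_mat_relabel[OF inj sub _ x f[OF j]]) (auto simp: implements_def)
  \<comment> \<open>This column of \<open>?C\<close> belongs to an encoded basis vector, so the
    hypothesis that \<open>C\<close> implements \<open>V\<close> applies.\<close>
  also have "?C $$ (?p x, e (\<pi> j)) = (?C * ?E) $$ (?p x, \<pi> j)"
    using \<pi>j pull[OF j] pull_bits_less[of \<sigma> "q + a" "f j"]
    by (subst index_mult_encoding_mat) simp_all
  also have "\<dots> = (?E * V) $$ (?p x, \<pi> j)"
    using C by (simp add: implements_def)
  also have "\<dots> = (\<Sum>i<n. if ?p x = e i then V $$ (i, \<pi> j) else 0)"
    using \<pi>j V by (intro index_encoding_mat_mult) simp_all
  also have "\<dots> = (\<Sum>i | i < N \<and> \<rho> i = \<rho> j. if ?p x = e (\<pi> i) then V $$ (\<pi> i, \<pi> j) else 0)"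
    by (rule sum.reindex_bij_betw[OF bij[OF j], symmetric])
  also have "(if agree_off ?S m x (f j) then \<dots> else 0) =
      (\<Sum>i | i < N \<and> \<rho> i = \<rho> j. if x = f i then V $$ (\<pi> i, \<pi> j) else 0)"
  proof -
    \<comment> \<open>As \<open>i\<close> and \<open>j\<close> have the same
      \<open>\<rho>\<close>-component, \<open>f i\<close> and \<open>f j\<close> coincide on the
      qubits that the circuit does not touch.\<close>
    have "x = f i \<longleftrightarrow> agree_off ?S m x (f j) \<and> ?p x = e (\<pi> i)" if "i < N" "\<rho> i = \<rho> j" for i
      using agree[OF that(1) j that(2)] pull[OF that(1)] f[OF that(1)]
      by (subst eq_iff_agree_off_pull_bits[OF sub x]) (auto simp: agree_off_def)
    then show ?thesis
      by (auto intro!: sum.cong sum.neutral)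
  qed
  also have "\<dots> = (\<Sum>i<N. if \<rho> i = \<rho> j then (if x = f i then V $$ (\<pi> i, \<pi> j) else 0) else 0)"
    by (subst sum.inter_filter[symmetric]) (auto intro!: sum.cong)
  also have "\<dots> = (?F * W) $$ (x, j)"
    using x j W by (subst index_encoding_mat_mult) (auto simp: W_index intro!: sum.cong)
  finally show "(?D * ?F) $$ (x, j) = (?F * W) $$ (x, j)" .
qed (use W carrier_matD[OF circuit_mat_carrier] in \<open>auto simp: encoding_mat_def\<close>)

section \<open>Implementing Kronecker products\<close>

text \<open>The first register occupies the low \<open>q\<close> qubits and the second lies above
  it. If the values of \<open>e\<close> are below \<open>2 ^ q\<close>, the bits do not overlap and
  \<open>or\<close> is addition.\<close>

definition pair_encoding :: "nat \<Rightarrow> nat \<Rightarrow> (nat \<Rightarrow> nat) \<Rightarrow> (nat \<Rightarrow> nat) \<Rightarrow> nat \<Rightarrow> nat" where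
  "pair_encoding q n e f i = or (e (i div n)) (push_bit q (f (i mod n)))"

lemma bit_pair_encoding:
  assumes "encoding n1 q1 e1" and "i < n1 * n2"
  shows "bit (pair_encoding q1 n2 e1 e2 i) l \<longleftrightarrow>
    (if l < q1 then bit (e1 (i div n2)) l else bit (e2 (i mod n2)) (l - q1))"
proof -
  have "e1 (i div n2) < 2 ^ q1"
    using assms less_mult_imp_div_less[of i n1 n2] by (auto simp: encoding_def)
  then have "\<not> bit (e1 (i div n2)) l" if "q1 \<le> l"
    using that bit_nat_less_exp_imp_less not_less by blast
  then show ?thesis
    by (auto simp: pair_encoding_def bit_or_iff bit_push_bit_iff)
qed

lemma nat_less_exp_if_bits: "(\<And>l. bit x l \<Longrightarrow> l < m) \<Longrightarrow> x < 2 ^ m" for x :: nat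
  by (metis bit_eq_iff bit_take_bit_iff take_bit_nat_less_exp)

lemma pair_encoding_less:
  assumes e1: "encoding n1 q1 e1" and e2: "encoding n2 q2 e2" and i: "i < n1 * n2"
  shows "pair_encoding q1 n2 e1 e2 i < 2 ^ (q1 + q2)"
proof (rule nat_less_exp_if_bits)
  fix l assume l: "bit (pair_encoding q1 n2 e1 e2 i) l"
  have "e2 (i mod n2) < 2 ^ q2"
    using e2 mod_less_of_less_mult[OF i] by (auto simp: encoding_def)
  then show "l < q1 + q2"
    using l bit_nat_less_exp_imp_less[of "e2 (i mod n2)" "l - q1" q2]
    by (auto simp: bit_pair_encoding[OF e1 i] split: if_splits)
qed

lemma encoding_pair_encoding:
  assumes e1: "encoding n1 q1 e1" and e2: "encoding n2 q2 e2"
  shows "encoding (n1 * n2) (q1 + q2) (pair_encoding q1 n2 e1 e2)"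
  unfolding encoding_def
proof (intro conjI allI impI)
  show "pair_encoding q1 n2 e1 e2 ` {..<n1 * n2} \<subseteq> {..<2 ^ (q1 + q2)}"
    using pair_encoding_less[OF e1 e2] by auto
  show "inj_on (pair_encoding q1 n2 e1 e2) {..<n1 * n2}"
  proof (rule inj_onI)
    fix i j assume "i \<in> {..<n1 * n2}" "j \<in> {..<n1 * n2}"
      and eq: "pair_encoding q1 n2 e1 e2 i = pair_encoding q1 n2 e1 e2 j"
    then have i: "i < n1 * n2" and j: "j < n1 * n2" by simp_all
    note bounds = less_mult_imp_div_less[OF i] less_mult_imp_div_less[OF j]
      mod_less_of_less_mult[OF i] mod_less_of_less_mult[OF j]
    have bits: "(if l < q1 then bit (e1 (i div n2)) l else bit (e2 (i mod n2)) (l - q1)) \<longleftrightarrow>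
        (if l < q1 then bit (e1 (j div n2)) l else bit (e2 (j mod n2)) (l - q1))" for l
      using eq bit_pair_encoding[OF e1 i, of e2 l] bit_pair_encoding[OF e1 j, of e2 l] by simp
    have "e1 (i div n2) < 2 ^ q1" "e1 (j div n2) < 2 ^ q1"
      using e1 bounds by (auto simp: encoding_def)
    then have "e1 (i div n2) = e1 (j div n2)"
      using bits nat_eq_iff_bits by (metis (full_types))
    moreover have "e2 (i mod n2) = e2 (j mod n2)"
      by (rule bit_eqI) (use bits[of "q1 + _"] in simp)
    ultimately have "i div n2 = j div n2" "i mod n2 = j mod n2"
      using e1 e2 bounds unfolding encoding_def inj_on_def by blast+
    then show "i = j"
      by (metis div_mult_mod_eq)
  qed
  fix m assume "n1 * n2 = 2 ^ m"
  \<comment> \<open>Since 2 is prime, both factors are powers of two, and each given encoding then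
    has a register of exactly the matching size.\<close>
  then obtain i j where "n1 = 2 ^ i" "n2 = 2 ^ j" "m = i + j"
    using prime_power_mult_nat[of 2 n1 n2 m] by (metis power_add power_inject_exp one_less_numeral_iff semiring_norm(76) two_is_prime_nat)
  then show "q1 + q2 = m"
    using e1 e2 by (auto simp: encoding_def)
qed

text \<open>The fibre consists of the pairs that share the second coordinate of \<open>j\<close>,
  hence is a copy of the first factor. It is the bijection needed for a circuit acting on the first
  register alone.\<close>

lemma bij_betw_div_fiber:
  fixes n1 n2 :: nat
  assumes "j < n1 * n2"
  shows "bij_betw (\<lambda>i. i div n2) {i. i < n1 * n2 \<and> i mod n2 = j mod n2} {..<n1}"
proof (rule bij_betw_byWitness[where f' = "\<lambda>k. k * n2 + j mod n2"])
  have "n2 > 0"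
    using assms by (cases n2) auto
  then have "k * n2 + j mod n2 < n1 * n2" if "k < n1" for k
    using that mod_less_divisor by (intro mult_add_less_mult) auto
  then show "(\<lambda>k. k * n2 + j mod n2) ` {..<n1} \<subseteq> {i. i < n1 * n2 \<and> i mod n2 = j mod n2}"
    by auto
  show "\<forall>a'\<in>{..<n1}. (a' * n2 + j mod n2) div n2 = a'"
    using \<open>n2 > 0\<close> by simp
qed (auto simp: less_mult_imp_div_less, metis div_mult_mod_eq)

lemma bij_betw_mod_fiber:
  fixes n1 n2 :: nat
  assumes "j < n1 * n2"
  shows "bij_betw (\<lambda>i. i mod n2) {i. i < n1 * n2 \<and> i div n2 = j div n2} {..<n2}"
proof (rule bij_betw_byWitness[where f' = "\<lambda>k. j div n2 * n2 + k"])
  have "j div n2 * n2 + k < n1 * n2" if "k < n2" for k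
    using that less_mult_imp_div_less[OF assms] by (intro mult_add_less_mult)
  then show "(\<lambda>k. j div n2 * n2 + k) ` {..<n2} \<subseteq> {i. i < n1 * n2 \<and> i div n2 = j div n2}"
    by auto
qed (auto simp: mod_less_of_less_mult, metis div_mult_mod_eq)

text \<open>
  The second circuit reuses the ancillas of the first one, which have been returned to zero.
\<close>

lemma implements_kronecker:
  assumes e1: "encoding n1 q1 e1" and e2: "encoding n2 q2 e2"
    and C1: "implements n1 q1 e1 a1 C1 V1" and C2: "implements n2 q2 e2 a2 C2 V2"
    and V1: "V1 \<in> carrier_mat n1 n1" and V2: "V2 \<in> carrier_mat n2 n2"
  obtains C where
    "implements (n1 * n2) (q1 + q2) (pair_encoding q1 n2 e1 e2) (max a1 a2) C (kronecker V1 V2)"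
    and "length C = length C1 + length C2"
proof
  define m where "m = q1 + q2 + max a1 a2"
  \<comment> \<open>Register 1 stays in place and its ancillas jump over register 2;
    \<open>\<sigma>2\<close> shifts everything past register 1. Both ancilla blocks thus start at
    qubit \<open>q1 + q2\<close> and overlap.\<close>
  define \<sigma>1 where "\<sigma>1 l = (if l < q1 then l else q2 + l)" for l
  define \<sigma>2 where "\<sigma>2 l = q1 + l" for l
  let ?f = "pair_encoding q1 n2 e1 e2"
  let ?F = "encoding_mat m (n1 * n2) ?f"
  let ?D1 = "map (relabel_gate \<sigma>1) C1" and ?D2 = "map (relabel_gate \<sigma>2) C2"
  let ?W1 = "kronecker V1 (1\<^sub>m n2)" and ?W2 = "kronecker (1\<^sub>m n1) V2"
  have \<sigma>1: "inj_on \<sigma>1 {..<q1 + a1}" "\<sigma>1 ` {..<q1 + a1} \<subseteq> {..<m}"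
    and \<sigma>2: "inj_on \<sigma>2 {..<q2 + a2}" "\<sigma>2 ` {..<q2 + a2} \<subseteq> {..<m}"
    by (auto simp: \<sigma>1_def \<sigma>2_def m_def inj_on_def)
  have W: "?W1 \<in> carrier_mat (n1 * n2) (n1 * n2)" "?W2 \<in> carrier_mat (n1 * n2) (n1 * n2)"
    using V1 V2 by (auto intro!: carrier_matI)
  have f: "?f i < 2 ^ m" if "i < n1 * n2" for i
    using pair_encoding_less[OF e1 e2 that]
    by (rule less_le_trans) (simp add: m_def)
  have e1_bit: "l < q1" if "i < n1 * n2" "bit (e1 (i div n2)) l" for i l
    using that e1 less_mult_imp_div_less[OF that(1)] bit_nat_less_exp_imp_less
    by (auto simp: encoding_def)
  have e2_bit: "l < q2" if "i < n1 * n2" "bit (e2 (i mod n2)) l" for i l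
    using that e2 mod_less_of_less_mult[OF that(1)] bit_nat_less_exp_imp_less
    by (auto simp: encoding_def)
  have pull1: "pull_bits \<sigma>1 (q1 + a1) (?f i) = e1 (i div n2)" if "i < n1 * n2" for i
  proof (rule bit_eqI)
    fix l
    show "bit (pull_bits \<sigma>1 (q1 + a1) (?f i)) l \<longleftrightarrow> bit (e1 (i div n2)) l"
      \<comment> \<open>For an ancilla, \<open>q1 \<le> l\<close>, the bit read is bit
        \<open>q2 + l - q1\<close> of a value of \<open>e2\<close>; this index is at least
        \<open>q2\<close>, so the bit is zero.\<close>
      using e1_bit[OF that, of l] e2_bit[OF that, of "q2 + l - q1"]
      by (cases "l < q1") (auto simp: \<sigma>1_def bit_pair_encoding[OF e1 that])
  qed
  have pull2: "pull_bits \<sigma>2 (q2 + a2) (?f i) = e2 (i mod n2)" if "i < n1 * n2" for i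
    using e2_bit[OF that]
    by (intro bit_eqI) (auto intro: trans_less_add1 simp: \<sigma>2_def bit_pair_encoding[OF e1 that])
  have D1: "circuit_mat m ?D1 * ?F = ?F * ?W1"
  proof (rule circuit_mat_relabel_encoding_mat[OF \<sigma>1 C1 V1 W(1) f pull1])
    show "agree_off (\<sigma>1 ` {..<q1 + a1}) m (?f i) (?f j)"
      if "i < n1 * n2" "j < n1 * n2" "i mod n2 = j mod n2" for i j
    proof -
      have "l \<in> \<sigma>1 ` {..<q1 + a1}" if "l < q1" for l
        using that by (intro image_eqI[of _ _ l]) (auto simp: \<sigma>1_def)
      then show ?thesis
        using that by (auto simp: agree_off_def bit_pair_encoding[OF e1])
    qed
    show "?W1 $$ (i, j) = (if i mod n2 = j mod n2 then V1 $$ (i div n2, j div n2) else 0)"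
      if "i < n1 * n2" "j < n1 * n2" for i j
      using that V1 mod_less_of_less_mult by auto
  qed (auto intro: bij_betw_div_fiber)
  have D2: "circuit_mat m ?D2 * ?F = ?F * ?W2"
  proof (rule circuit_mat_relabel_encoding_mat[OF \<sigma>2 C2 V2 W(2) f pull2])
    show "agree_off (\<sigma>2 ` {..<q2 + a2}) m (?f i) (?f j)"
      if "i < n1 * n2" "j < n1 * n2" "i div n2 = j div n2" for i j
    proof -
      \<comment> \<open>A qubit outside register 1 that the second circuit does not touch is a
        surplus ancilla, where both encoded states are zero.\<close>
      have "l - q1 \<ge> q2" if "l \<notin> \<sigma>2 ` {..<q2 + a2}" "\<not> l < q1" for l
      proof (rule ccontr)
        assume "\<not> l - q1 \<ge> q2"
        then have "l - q1 < q2 + a2" "l = \<sigma>2 (l - q1)"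
          using that by (auto simp: \<sigma>2_def)
        then show False
          using that by blast
      qed
      then show ?thesis
        using that e2_bit[OF that(1)] e2_bit[OF that(2)] unfolding agree_off_def
        by (auto simp: bit_pair_encoding[OF e1] not_le[symmetric])
    qed
    show "?W2 $$ (i, j) = (if i div n2 = j div n2 then V2 $$ (i mod n2, j mod n2) else 0)"
      if "i < n1 * n2" "j < n1 * n2" for i j
      using that V2 less_mult_imp_div_less by auto
  qed (auto intro: bij_betw_mod_fiber)
  have F: "?F \<in> carrier_mat (2 ^ m) (n1 * n2)"
    by (simp add: encoding_mat_def)
  \<comment> \<open>The encoding matrix is moved leftwards past one circuit at a time, which leaves
    the product of the two local operators.\<close>
  have "circuit_mat m (?D1 @ ?D2) * ?F = circuit_mat m ?D2 * (?F * ?W1)"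
    by (simp add: circuit_mat_append assoc_mult_mat[OF circuit_mat_carrier circuit_mat_carrier F] D1)
  also have "\<dots> = ?F * (?W2 * ?W1)"
    by (simp add: assoc_mult_mat[OF circuit_mat_carrier F W(1), symmetric] D2 assoc_mult_mat[OF F W(2) W(1)])
  also have "?W2 * ?W1 = kronecker V1 V2"
    using V1 V2 by (subst kronecker_mult) auto
  finally show "implements (n1 * n2) (q1 + q2) ?f (max a1 a2) (?D1 @ ?D2) (kronecker V1 V2)"
    using C1 C2 valid_relabel_gate[OF \<sigma>1] valid_relabel_gate[OF \<sigma>2]
    unfolding implements_def m_def by auto
  show "length (?D1 @ ?D2) = length C1 + length C2"
    by simp
qed

section \<open>Bounding the gate count of the product walk\<close>

lemma real_poly_monotone_majorant:
  fixes p :: "real poly"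
  obtains p' where "\<And>x. 0 \<le> x \<Longrightarrow> poly p x \<le> poly p' x" and "\<And>x. 0 \<le> x \<Longrightarrow> 0 \<le> poly p' x"
    and "\<And>x y. 0 \<le> x \<Longrightarrow> x \<le> y \<Longrightarrow> poly p' x \<le> poly p' y"
proof -
  have "\<exists>p'. (\<forall>x\<ge>0. poly p x \<le> poly p' x \<and> 0 \<le> poly p' x \<and> (\<forall>y\<ge>x. poly p' x \<le> poly p' y))"
  proof (induction p)
    case 0
    show ?case by (intro exI[of _ 0]) simp
  next
    case (pCons c p)
    then obtain p' where "\<forall>x\<ge>0. poly p x \<le> poly p' x \<and> 0 \<le> poly p' x \<and> (\<forall>y\<ge>x. poly p' x \<le> poly p' y)"
      by blast
    then show ?case
      \<comment> \<open>Coefficients are replaced by their absolute values, which makes the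
        polynomial nonnegative and monotone on the nonnegative reals.\<close>
      by (intro exI[of _ "pCons \<bar>c\<bar> p'"]) (auto intro!: add_mono mult_mono mult_left_mono)
  qed
  then show ?thesis
    using that by blast
qed

theorem mainTheorem4:
  fixes \<gamma> :: real
    and A B :: "'k \<Rightarrow> complex mat"
  assumes "\<And>k. is_adjacency_matrix (A k)"
    and "\<And>k. is_adjacency_matrix (B k)"
    and "efficiently_implementable_ctqw \<gamma> A"
    and "efficiently_implementable_ctqw \<gamma> B"
  shows "(\<forall>k. \<forall>t\<ge>0. ctqw \<gamma> (cartesian_product_mat (A k) (B k)) t =
                       kronecker (ctqw \<gamma> (A k) t) (ctqw \<gamma> (B k) t)) \<and>
         efficiently_implementable_ctqw \<gamma> (\<lambda>k. cartesian_product_mat (A k) (B k))"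
proof
  let ?n = "\<lambda>k. dim_row (A k)" and ?m = "\<lambda>k. dim_row (B k)"
  have A: "A k \<in> carrier_mat (?n k) (?n k)" and B: "B k \<in> carrier_mat (?m k) (?m k)" for k
    using assms(1,2)[of k] by (auto simp: is_adjacency_matrix_def adjacency_matrix_def)
  have exp: "ctqw \<gamma> (cartesian_product_mat (A k) (B k)) t =
      kronecker (ctqw \<gamma> (A k) t) (ctqw \<gamma> (B k) t)" for k t
    by (rule ctqw_cartesian_product_mat[OF A B])
  then show "\<forall>k. \<forall>t\<ge>0. ctqw \<gamma> (cartesian_product_mat (A k) (B k)) t =
      kronecker (ctqw \<gamma> (A k) t) (ctqw \<gamma> (B k) t)"
    by blast
  obtain q1 e1 p1 where 1: "\<And>k. encoding (?n k) (q1 k) (e1 k)"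
    "\<And>k t. t \<ge> 0 \<Longrightarrow> \<exists>a C. implements (?n k) (q1 k) (e1 k) a C (ctqw \<gamma> (A k) t) \<and>
       real (length C) \<le> poly p1 (log 2 (real (?n k)))"
    using assms(3) unfolding efficiently_implementable_ctqw_def by blast
  obtain q2 e2 p2 where 2: "\<And>k. encoding (?m k) (q2 k) (e2 k)"
    "\<And>k t. t \<ge> 0 \<Longrightarrow> \<exists>a C. implements (?m k) (q2 k) (e2 k) a C (ctqw \<gamma> (B k) t) \<and>
       real (length C) \<le> poly p2 (log 2 (real (?m k)))"
    using assms(4) unfolding efficiently_implementable_ctqw_def by blast
  obtain r1 where r1: "\<And>x. 0 \<le> x \<Longrightarrow> poly p1 x \<le> poly r1 x" "\<And>x. 0 \<le> x \<Longrightarrow> 0 \<le> poly r1 x"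
    "\<And>x y. 0 \<le> x \<Longrightarrow> x \<le> y \<Longrightarrow> poly r1 x \<le> poly r1 y"
    using real_poly_monotone_majorant[of p1] by metis
  obtain r2 where r2: "\<And>x. 0 \<le> x \<Longrightarrow> poly p2 x \<le> poly r2 x" "\<And>x. 0 \<le> x \<Longrightarrow> 0 \<le> poly r2 x"
    "\<And>x y. 0 \<le> x \<Longrightarrow> x \<le> y \<Longrightarrow> poly r2 x \<le> poly r2 y"
    using real_poly_monotone_majorant[of p2] by metis
  let ?f = "\<lambda>k. pair_encoding (q1 k) (?m k) (e1 k) (e2 k)"
  have "\<exists>a C. implements (?n k * ?m k) (q1 k + q2 k) (?f k) a C
        (ctqw \<gamma> (cartesian_product_mat (A k) (B k)) t) \<and>
      real (length C) \<le> poly (r1 + r2) (log 2 (real (?n k * ?m k)))" if t: "t \<ge> 0" for k t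
  \<comment> \<open>If one graph is empty, the logarithm of the product size is 0 by convention and
    does not dominate that of the other factor. The space is then zero-dimensional and the empty
    circuit suffices.\<close>
  proof (cases "?n k * ?m k = 0")
    case True
    have "implements (?n k * ?m k) (q1 k + q2 k) (?f k) 0 []
        (ctqw \<gamma> (cartesian_product_mat (A k) (B k)) t)"
      unfolding implements_def using True
      by (auto intro!: eq_matI simp: encoding_mat_def ctqw_def mat_exp_def)
    moreover have "0 \<le> poly (r1 + r2) (log 2 (real (?n k * ?m k)))"
      unfolding True using r1(2)[of 0] r2(2)[of 0] by (simp add: log_def)
    ultimately show ?thesis
      by (metis list.size(3) of_nat_0)
  next
    case False
    then have pos: "real (?n k) \<ge> 1" "real (?m k) \<ge> 1"
      by auto
    then have logs: "0 \<le> log 2 (real (?n k))" "0 \<le> log 2 (real (?m k))"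
      "log 2 (real (?n k * ?m k)) = log 2 (real (?n k)) + log 2 (real (?m k))"
      by (auto simp: log_mult)
    obtain a1 C1 where C1: "implements (?n k) (q1 k) (e1 k) a1 C1 (ctqw \<gamma> (A k) t)"
      "real (length C1) \<le> poly p1 (log 2 (real (?n k)))"
      using 1(2)[OF t] by blast
    obtain a2 C2 where C2: "implements (?m k) (q2 k) (e2 k) a2 C2 (ctqw \<gamma> (B k) t)"
      "real (length C2) \<le> poly p2 (log 2 (real (?m k)))"
      using 2(2)[OF t] by blast
    obtain C where C: "implements (?n k * ?m k) (q1 k + q2 k) (?f k) (max a1 a2) C
        (kronecker (ctqw \<gamma> (A k) t) (ctqw \<gamma> (B k) t))" "length C = length C1 + length C2"
      by (rule implements_kronecker[OF 1(1) 2(1) C1(1) C2(1)]) (auto simp: ctqw_def mat_exp_def)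
    have "real (length C) \<le> poly r1 (log 2 (real (?n k))) + poly r2 (log 2 (real (?m k)))"
      using C(2) C1(2) C2(2) r1(1)[OF logs(1)] r2(1)[OF logs(2)] by simp
    \<comment> \<open>Both logarithms are nonnegative, so each is at most their sum and monotonicity
      applies.\<close>
    also have "\<dots> \<le> poly (r1 + r2) (log 2 (real (?n k * ?m k)))"
      unfolding logs(3) poly_add using logs(1,2) by (intro add_mono r1(3) r2(3)) auto
    finally show ?thesis
      using C(1) exp by auto
  qed
  then have "\<forall>k. encoding (?n k * ?m k) (q1 k + q2 k) (?f k) \<and>
      (\<forall>t\<ge>0. \<exists>a C. implements (?n k * ?m k) (q1 k + q2 k) (?f k) a C
          (ctqw \<gamma> (cartesian_product_mat (A k) (B k)) t) \<and>
        real (length C) \<le> poly (r1 + r2) (log 2 (real (?n k * ?m k))))"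
    using encoding_pair_encoding[OF 1(1) 2(1)] by blast
  then show "efficiently_implementable_ctqw \<gamma> (\<lambda>k. cartesian_product_mat (A k) (B k))"
    unfolding efficiently_implementable_ctqw_def dim_cartesian_product_mat
    by (rule exI[of _ "r1 + r2", THEN exI[of _ ?f], THEN exI[of _ "\<lambda>k. q1 k + q2 k"]])
qed

end
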